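(* Let $(J_1,J_2,J_3)$ be an almost hypercomplex structure on a $4n$-dimensional manifold $M$ equipped with a pseudo-Riemannian metric $g$. If two of the six associated Nijenhuis tensors $$\{J_1,J_1\},\quad\{J_2,J_2\},\quad\{J_3,J_3\},\quad\{J_1,J_2\},\quad\{J_2,J_3\},\quad\{J_3,J_1\}$$ vanish, then the others also vanish.
   Context: An almost hypercomplex structure on $M$ is a triad of almost complex structures with $J_\alpha=J_\beta\circ J_\gamma=-J_\gamma\circ J_\beta$ and $J_\alpha^2=-I$ for all cyclic permutations $(\alpha,\beta,\gamma)$ of $(1,2,3)$. With $\nabla$ the Levi-Civita connection of $g$, put $\{x,y\}=\nabla_xy+\nabla_yx$ for vector fields $x,y$. The associated Nijenhuis tensor of two $(1,1)$-tensors $J,K$ is the $(1,2)$-tensor $\{J,K\}$ defined by \begin{align*}2\{J,K\}(x,y)=\ &(JK+KJ)\{x,y\}+\{Jx,Ky\}-J\{Kx,y\}-J\{x,Ky\}\\&+\{Kx,Jy\}-K\{Jx,y\}-K\{x,Jy\}.\end{align*} *)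

theory Defs
  imports "HOL-Analysis.Analysis" "HOL-Library.Function_Algebras"
begin

section \<open>Smooth manifolds\<close>

fun Ck_on :: "nat \<Rightarrow> 'a::real_normed_vector set \<Rightarrow> ('a \<Rightarrow> 'b::real_normed_vector) \<Rightarrow> bool" where
  "Ck_on 0 S f \<longleftrightarrow> continuous_on S f"
| "Ck_on (Suc k) S f \<longleftrightarrow>
     (\<forall>x\<in>S. f differentiable (at x)) \<and> (\<forall>v. Ck_on k S (\<lambda>x. frechet_derivative f (at x) v))"

text \<open>Only used for open \<open>S\<close> in a Euclidean space.\<close>
definition smooth_on :: "'a::real_normed_vector set \<Rightarrow> ('a \<Rightarrow> 'b::real_normed_vector) \<Rightarrow> bool" where
  "smooth_on S f \<longleftrightarrow> (\<forall>k. Ck_on k S f)"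

text \<open>A chart is a pair \<open>(U, \<phi>)\<close>; values of \<open>\<phi>\<close> outside \<open>U\<close> are irrelevant. The atlas need
  not be maximal.\<close>
record ('m, 'e) charted_space =
  mtop :: "'m topology"
  atlas :: "('m set \<times> ('m \<Rightarrow> 'e)) set"

abbreviation points :: "('m, 'e, 'z) charted_space_scheme \<Rightarrow> 'm set" where
  "points M \<equiv> topspace (mtop M)"

text \<open>The dimension of the manifold is \<open>DIM('e)\<close>.\<close>
definition smooth_manifold :: "('m, 'e::euclidean_space) charted_space \<Rightarrow> bool" where
  "smooth_manifold M \<longleftrightarrow>
     Hausdorff_space (mtop M) \<and> second_countable (mtop M) \<and>
     (\<forall>(U, \<phi>)\<in>atlas M. openin (mtop M) U \<and> open (\<phi> ` U) \<and>
        homeomorphic_map (subtopology (mtop M) U) (top_of_set (\<phi> ` U)) \<phi>) \<and>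
     points M = (\<Union>(U, \<phi>)\<in>atlas M. U) \<and>
     (\<forall>(U, \<phi>)\<in>atlas M. \<forall>(V, \<psi>)\<in>atlas M.
        smooth_on (\<phi> ` (U \<inter> V)) (\<psi> \<circ> inv_into U \<phi>))"

text \<open>Values of \<open>f\<close> outside the manifold are irrelevant.\<close>
definition smooth_fun :: "('m, 'e::euclidean_space) charted_space \<Rightarrow> ('m \<Rightarrow> real) \<Rightarrow> bool" where
  "smooth_fun M f \<longleftrightarrow> (\<forall>(U, \<phi>)\<in>atlas M. smooth_on (\<phi> ` U) (f \<circ> inv_into U \<phi>))"


section \<open>Tangent vectors, vector fields, tensor fields\<close>

text \<open>Tangent vectors at \<open>p\<close> are the derivations at \<open>p\<close> of the algebra of smooth functions. As HOL
  functions are total, they are required to be \<open>0\<close> on functions that are not smooth; likewise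
  vector fields and (1,1)-tensor fields are \<open>0\<close> at points outside the manifold. With these
  conventions, equality of tangent vectors and of vector fields is HOL equality.
  Addition, negation and zero on function types are pointwise (from
  \<^theory>\<open>HOL-Library.Function_Algebras\<close>).\<close>

type_synonym 'm tvec = "('m \<Rightarrow> real) \<Rightarrow> real"
type_synonym 'm vfield = "'m \<Rightarrow> 'm tvec"
type_synonym 'm tensor11 = "'m \<Rightarrow> 'm tvec \<Rightarrow> 'm tvec"
type_synonym 'm tensor02 = "'m \<Rightarrow> 'm tvec \<Rightarrow> 'm tvec \<Rightarrow> real"

definition tangent_space :: "('m, 'e::euclidean_space) charted_space \<Rightarrow> 'm \<Rightarrow> 'm tvec set" where
  "tangent_space M p = {D.
     (\<forall>f h. smooth_fun M f \<longrightarrow> smooth_fun M h \<longrightarrow>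
        D (\<lambda>q. f q + h q) = D f + D h \<and>
        D (\<lambda>q. f q * h q) = f p * D h + h p * D f) \<and>
     (\<forall>c f. smooth_fun M f \<longrightarrow> D (\<lambda>q. c * f q) = c * D f) \<and>
     (\<forall>f. \<not> smooth_fun M f \<longrightarrow> D f = 0)}"

definition tscale :: "real \<Rightarrow> 'm tvec \<Rightarrow> 'm tvec" where
  "tscale c v = (\<lambda>f. c * v f)"

definition vector_field :: "('m, 'e::euclidean_space) charted_space \<Rightarrow> 'm vfield \<Rightarrow> bool" where
  "vector_field M X \<longleftrightarrow>
     (\<forall>p\<in>points M. X p \<in> tangent_space M p) \<and>
     (\<forall>p. p \<notin> points M \<longrightarrow> X p = 0) \<and>
     (\<forall>f. smooth_fun M f \<longrightarrow> smooth_fun M (\<lambda>p. X p f))"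

definition fscale :: "('m \<Rightarrow> real) \<Rightarrow> 'm vfield \<Rightarrow> 'm vfield" where
  "fscale f X = (\<lambda>p. tscale (f p) (X p))"

definition deriv_along :: "'m vfield \<Rightarrow> ('m \<Rightarrow> real) \<Rightarrow> 'm \<Rightarrow> real" where
  "deriv_along X f = (\<lambda>p. X p f)"

definition lie_bracket :: "'m vfield \<Rightarrow> 'm vfield \<Rightarrow> 'm vfield" where
  "lie_bracket X Y = (\<lambda>p f. X p (deriv_along Y f) - Y p (deriv_along X f))"

definition tapply :: "'m tensor11 \<Rightarrow> 'm vfield \<Rightarrow> 'm vfield" where
  "tapply J X = (\<lambda>p. J p (X p))"

text \<open>Smoothness of a tensor field is expressed by its mapping smooth vector fields to smooth
  vector fields (respectively smooth functions).\<close>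
definition tensor11_field :: "('m, 'e::euclidean_space) charted_space \<Rightarrow> 'm tensor11 \<Rightarrow> bool" where
  "tensor11_field M J \<longleftrightarrow>
     (\<forall>p\<in>points M.
        (\<forall>v\<in>tangent_space M p. J p v \<in> tangent_space M p) \<and>
        (\<forall>v\<in>tangent_space M p. \<forall>w\<in>tangent_space M p. J p (v + w) = J p v + J p w) \<and>
        (\<forall>c. \<forall>v\<in>tangent_space M p. J p (tscale c v) = tscale c (J p v))) \<and>
     (\<forall>p v. p \<notin> points M \<longrightarrow> J p v = 0) \<and>
     (\<forall>X. vector_field M X \<longrightarrow> vector_field M (tapply J X))"

definition pseudo_riemannian_metric ::
    "('m, 'e::euclidean_space) charted_space \<Rightarrow> 'm tensor02 \<Rightarrow> bool" where
  "pseudo_riemannian_metric M g \<longleftrightarrow>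
     (\<forall>p\<in>points M.
        (\<forall>v\<in>tangent_space M p. \<forall>w\<in>tangent_space M p. g p v w = g p w v) \<and>
        (\<forall>u\<in>tangent_space M p. \<forall>v\<in>tangent_space M p. \<forall>w\<in>tangent_space M p.
           g p (u + v) w = g p u w + g p v w) \<and>
        (\<forall>c. \<forall>v\<in>tangent_space M p. \<forall>w\<in>tangent_space M p. g p (tscale c v) w = c * g p v w) \<and>
        (\<forall>v\<in>tangent_space M p. (\<forall>w\<in>tangent_space M p. g p v w = 0) \<longrightarrow> v = 0)) \<and>
     (\<forall>X Y. vector_field M X \<longrightarrow> vector_field M Y \<longrightarrow> smooth_fun M (\<lambda>p. g p (X p) (Y p)))"


section \<open>The Levi-Civita connection\<close>

text \<open>\<open>nabla X Y\<close> is the covariant derivative of \<open>Y\<close> along \<open>X\<close>.\<close>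
type_synonym 'm connection = "'m vfield \<Rightarrow> 'm vfield \<Rightarrow> 'm vfield"

definition affine_connection ::
    "('m, 'e::euclidean_space) charted_space \<Rightarrow> 'm connection \<Rightarrow> bool" where
  "affine_connection M nabla \<longleftrightarrow>
     (\<forall>X Y. vector_field M X \<longrightarrow> vector_field M Y \<longrightarrow> vector_field M (nabla X Y)) \<and>
     (\<forall>X Y Z. vector_field M X \<longrightarrow> vector_field M Y \<longrightarrow> vector_field M Z \<longrightarrow>
        nabla (X + Y) Z = nabla X Z + nabla Y Z \<and>
        nabla X (Y + Z) = nabla X Y + nabla X Z) \<and>
     (\<forall>f X Y. smooth_fun M f \<longrightarrow> vector_field M X \<longrightarrow> vector_field M Y \<longrightarrow>
        nabla (fscale f X) Y = fscale f (nabla X Y) \<and>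
        nabla X (fscale f Y) = fscale (deriv_along X f) Y + fscale f (nabla X Y))"

definition levi_civita_connection ::
    "('m, 'e::euclidean_space) charted_space \<Rightarrow> 'm tensor02 \<Rightarrow> 'm connection \<Rightarrow> bool" where
  "levi_civita_connection M g nabla \<longleftrightarrow>
     affine_connection M nabla \<and>
     (\<forall>X Y. vector_field M X \<longrightarrow> vector_field M Y \<longrightarrow>
        nabla X Y - nabla Y X = lie_bracket X Y) \<and>
     (\<forall>X Y Z. vector_field M X \<longrightarrow> vector_field M Y \<longrightarrow> vector_field M Z \<longrightarrow>
        (\<forall>p\<in>points M. X p (\<lambda>q. g q (Y q) (Z q)) =
           g p (nabla X Y p) (Z p) + g p (Y p) (nabla X Z p)))"


section \<open>Almost hypercomplex structures and associated Nijenhuis tensors\<close>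

definition almost_complex_structure ::
    "('m, 'e::euclidean_space) charted_space \<Rightarrow> 'm tensor11 \<Rightarrow> bool" where
  "almost_complex_structure M J \<longleftrightarrow>
     tensor11_field M J \<and> (\<forall>p\<in>points M. \<forall>v\<in>tangent_space M p. J p (J p v) = - v)"

text \<open>Only the values of \<open>J\<close> at the indices 1, 2, 3 matter.\<close>
definition almost_hypercomplex_structure ::
    "('m, 'e::euclidean_space) charted_space \<Rightarrow> (nat \<Rightarrow> 'm tensor11) \<Rightarrow> bool" where
  "almost_hypercomplex_structure M J \<longleftrightarrow>
     (\<forall>\<alpha>\<in>{1, 2, 3}. almost_complex_structure M (J \<alpha>)) \<and>
     (\<forall>(\<alpha>, \<beta>, \<gamma>)\<in>{(1, 2, 3), (2, 3, 1), (3, 1, 2)}.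
        \<forall>p\<in>points M. \<forall>v\<in>tangent_space M p.
          J \<alpha> p v = J \<beta> p (J \<gamma> p v) \<and> J \<alpha> p v = - J \<gamma> p (J \<beta> p v))"

definition sym_bracket :: "'m connection \<Rightarrow> 'm vfield \<Rightarrow> 'm vfield \<Rightarrow> 'm vfield" where
  "sym_bracket nabla x y = nabla x y + nabla y x"

definition assoc_nijenhuis ::
    "'m connection \<Rightarrow> 'm tensor11 \<Rightarrow> 'm tensor11 \<Rightarrow> 'm vfield \<Rightarrow> 'm vfield \<Rightarrow> 'm vfield" where
  "assoc_nijenhuis nabla J K x y =
     (let B = sym_bracket nabla; j = tapply J; k = tapply K in
      fscale (\<lambda>p. 1/2)
        (j (k (B x y)) + k (j (B x y))
         + B (j x) (k y) - j (B (k x) y) - j (B x (k y))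
         + B (k x) (j y) - k (B (j x) y) - k (B x (j y))))"

definition assoc_nijenhuis_vanishes ::
    "('m, 'e::euclidean_space) charted_space \<Rightarrow> 'm connection \<Rightarrow> 'm tensor11 \<Rightarrow> 'm tensor11 \<Rightarrow> bool" where
  "assoc_nijenhuis_vanishes M nabla J K \<longleftrightarrow>
     (\<forall>x y. vector_field M x \<longrightarrow> vector_field M y \<longrightarrow> assoc_nijenhuis nabla J K x y = 0)"

definition nijenhuis_index_pairs :: "(nat \<times> nat) set" where
  "nijenhuis_index_pairs = {(1, 1), (2, 2), (3, 3), (1, 2), (2, 3), (3, 1)}"

end

theory Submission
  imports Defs
begin

text \<open>
  Write \<open>B(x,y) = {x,y}\<close>. On maps \<open>F(x,y)\<close> of two vector fields, \<open>J\<^sub>a\<close> acts in three ways: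
  \<open>L\<^sub>a F = J\<^sub>a F(x,y)\<close>, \<open>P\<^sub>a F = F(J\<^sub>a x,y)\<close> and \<open>Q\<^sub>a F = F(x,J\<^sub>a y)\<close>. In these terms
  \<open>2{J\<^sub>a,J\<^sub>b} = (L\<^sub>a - P\<^sub>a)(L\<^sub>b - Q\<^sub>b) + (L\<^sub>b - P\<^sub>b)(L\<^sub>a - Q\<^sub>a)\<close> applied to \<open>B\<close>.
  Each of the triples \<open>L\<close>, \<open>-P\<close>, \<open>-Q\<close> satisfies the quaternion relations, and operators from
  different triples commute. After complexification this is the tensor product of three copies
  of the spin representation of dimension 2, which splits into spin 3/2 and two copies of
  spin 1/2. The operator \<open>(L\<^sub>a - P\<^sub>a)(L\<^sub>a - Q\<^sub>a)\<close> kills both spin 1/2 parts, and on spin 3/2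
  it is \<open>-4\<close> times the projection to the span of the states whose spin in direction \<open>a\<close> is
  \<open>3/2\<close> or \<open>-3/2\<close>.

  Let \<open>C = 3 + \<Sum>\<^sub>a (L\<^sub>a P\<^sub>a + L\<^sub>a Q\<^sub>a - P\<^sub>a Q\<^sub>a)\<close>, which is 6 times the projection to spin 3/2.
  Then all six associated Nijenhuis tensors vanish if and only if \<open>C B = 0\<close>: they factor through
  \<open>C\<close> (lemmas \<open>same_spin_component\<close> and \<open>mixed_spin_component\<close>), and conversely \<open>C\<close> is recovered

  \<^item> from a single mixed operator, because the square of an operator \<open>{J\<^sub>a,J\<^sub>b}\<close> with
    \<open>a \<noteq> b\<close> is \<open>C/2\<close> (lemma \<open>mixed_square\<close>);
  \<^item> from two of the operators \<open>{J\<^sub>a,J\<^sub>a}\<close>, because the states of extremal spin in two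
    orthogonal directions together span the whole of spin 3/2 (lemma \<open>two_squares\<close>).

  Two different index pairs either include a mixed one or are both of the form \<open>(a,a)\<close>, so
  the vanishing of two of the tensors always gives \<open>C B = 0\<close>.
\<close>

section \<open>Quaternionic actions on pairings\<close>

definition twice_nijenhuis ::
    "('v::ab_group_add \<Rightarrow> 'v) \<Rightarrow> ('v \<Rightarrow> 'v) \<Rightarrow> ('v \<Rightarrow> 'v \<Rightarrow> 'v) \<Rightarrow> 'v \<Rightarrow> 'v \<Rightarrow> 'v" where
  "twice_nijenhuis S T F x y =
     S (T (F x y)) + T (S (F x y))
     + F (S x) (T y) - S (F (T x) y) - S (F x (T y))
     + F (T x) (S y) - T (F (S x) y) - T (F x (S y))"

text \<open>One of three summands of the operator \<open>C\<close> of the introduction.\<close>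
definition spin_summand ::
    "('v::ab_group_add \<Rightarrow> 'v) \<Rightarrow> ('v \<Rightarrow> 'v \<Rightarrow> 'v) \<Rightarrow> 'v \<Rightarrow> 'v \<Rightarrow> 'v" where
  "spin_summand T F x y = F x y + T (F (T x) y) + T (F x (T y)) - F (T x) (T y)"

definition nat_multiple :: "nat \<Rightarrow> 'v::ab_group_add \<Rightarrow> 'v" where
  "nat_multiple n v = (\<Sum>i<n. v)"

lemma nat_multiple_simps:
  "nat_multiple 0 v = 0" "nat_multiple (Suc n) v = nat_multiple n v + v"
  "nat_multiple (numeral k) v = nat_multiple (pred_numeral k) v + v"
  by (simp_all add: nat_multiple_def numeral_eq_Suc)

text \<open>The arguments \<open>V\<close> are separated from the values \<open>W\<close>: a pairing of smooth fields may be
  regarded as taking values among all fields of tangent vectors, for which the additive closure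
  properties are pointwise.\<close>
locale hypercomplex_action =
  fixes V W :: "'v::ab_group_add set" and I J K :: "'v \<Rightarrow> 'v"
  assumes V_subset_W: "V \<subseteq> W"
    and W_zero: "0 \<in> W"
    and W_add: "\<And>u v. u \<in> W \<Longrightarrow> v \<in> W \<Longrightarrow> u + v \<in> W"
    and W_minus: "\<And>v. v \<in> W \<Longrightarrow> - v \<in> W"
    and V_action_ball: "\<forall>T\<in>{I, J, K}. \<forall>x\<in>V. T x \<in> V"
    and W_action_ball: "\<forall>T\<in>{I, J, K}. \<forall>v\<in>W. T v \<in> W"
    and action_add_ball: "\<forall>T\<in>{I, J, K}. \<forall>u\<in>W. \<forall>v\<in>W. T (u + v) = T u + T v"
    and action_square_ball: "\<forall>T\<in>{I, J, K}. \<forall>v\<in>W. T (T v) = - v"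
    and action_mult:
      "\<And>v. v \<in> W \<Longrightarrow> I (J v) = K v" "\<And>v. v \<in> W \<Longrightarrow> J (I v) = - K v"
      "\<And>v. v \<in> W \<Longrightarrow> J (K v) = I v" "\<And>v. v \<in> W \<Longrightarrow> K (J v) = - I v"
      "\<And>v. v \<in> W \<Longrightarrow> K (I v) = J v" "\<And>v. v \<in> W \<Longrightarrow> I (K v) = - J v"
    and torsion_free: "\<And>n v. n > 0 \<Longrightarrow> v \<in> W \<Longrightarrow> nat_multiple n v = 0 \<Longrightarrow> v = 0"
begin

lemmas V_action = V_action_ball[rule_format]
  and W_action = W_action_ball[rule_format]
  and action_add = action_add_ball[rule_format]
  and action_square = action_square_ball[rule_format]

text \<open>Cyclic permutation of the three structures reduces every statement on the six index pairs
  to the pairs \<open>(I,I)\<close> and \<open>(I,J)\<close>.\<close>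
lemma rotate: "hypercomplex_action V W J K I"
proof -
  have "{J, K, I} = {I, J, K}" by blast
  then show ?thesis
    using hypercomplex_action_axioms unfolding hypercomplex_action_def by simp
qed

lemma W_diff: "u \<in> W \<Longrightarrow> v \<in> W \<Longrightarrow> u - v \<in> W"
  using W_add[OF _ W_minus] by fastforce

lemma V_in_W: "x \<in> V \<Longrightarrow> x \<in> W"
  using V_subset_W by blast

lemma V_minus: "x \<in> V \<Longrightarrow> - x \<in> V"
  using action_square[of I x] V_action[of I] V_in_W by (metis insertI1)

lemma action_zero: "T \<in> {I, J, K} \<Longrightarrow> T 0 = 0"
  using action_add[OF _ W_zero W_zero] by (metis add.right_neutral add_cancel_right_right)

lemma action_minus: "T \<in> {I, J, K} \<Longrightarrow> v \<in> W \<Longrightarrow> T (- v) = - T v"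
  using action_add[of T v "- v"] action_zero W_minus
  by (metis add.right_inverse minus_unique)

lemma action_diff: "T \<in> {I, J, K} \<Longrightarrow> u \<in> W \<Longrightarrow> v \<in> W \<Longrightarrow> T (u - v) = T u - T v"
  using action_add[of T u "- v"] action_minus W_minus by (metis diff_conv_add_uminus)

lemmas action_simps =
  action_add[of I] action_add[of J] action_add[of K]
  action_diff[of I] action_diff[of J] action_diff[of K]
  action_minus[of I] action_minus[of J] action_minus[of K]
  action_zero[of I] action_zero[of J] action_zero[of K]
  action_square[of I] action_square[of J] action_square[of K] action_mult
  V_action[of I] V_action[of J] V_action[of K] V_minus V_in_W
  W_action[of I] W_action[of J] W_action[of K] W_add W_diff W_minus W_zero

text \<open>Oddness in each argument is what the reduction of a product such as \<open>F(J I x, y)\<close>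
  to \<open>- F(K x, y)\<close> asks for.\<close>
definition pairing :: "('v \<Rightarrow> 'v \<Rightarrow> 'v) \<Rightarrow> bool" where
  "pairing F \<longleftrightarrow> (\<forall>x\<in>V. \<forall>y\<in>V. F x y \<in> W \<and> F (- x) y = - F x y \<and> F x (- y) = - F x y)"

lemma pairingD:
  assumes "pairing F" "x \<in> V" "y \<in> V"
  shows "F x y \<in> W" "F (- x) y = - F x y" "F x (- y) = - F x y"
  using assms by (auto simp: pairing_def)

definition spin_component :: "('v \<Rightarrow> 'v \<Rightarrow> 'v) \<Rightarrow> 'v \<Rightarrow> 'v \<Rightarrow> 'v" where
  "spin_component F x y = spin_summand I F x y + spin_summand J F x y + spin_summand K F x y"

lemmas expand = twice_nijenhuis_def spin_component_def spin_summand_def nat_multiple_simps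
  action_simps pairingD algebra_simps

section \<open>Identities between the Nijenhuis operators\<close>

text \<open>The Nijenhuis operators vanish on the spin 1/2 parts, where \<open>C = 0\<close>, and \<open>C = 6\<close> on
  spin 3/2.\<close>
lemma same_spin_component:
  assumes "pairing F" "x \<in> V" "y \<in> V"
  shows "twice_nijenhuis I I (spin_component F) x y = nat_multiple 6 (twice_nijenhuis I I F x y)"
  using assms by (simp add: expand)

lemma mixed_spin_component:
  assumes "pairing F" "x \<in> V" "y \<in> V"
  shows "twice_nijenhuis I J (spin_component F) x y = nat_multiple 6 (twice_nijenhuis I J F x y)"
  using assms by (simp add: expand)

text \<open>On spin 3/2 with spin operators \<open>S\<^sub>a\<close>, the operator \<open>{J\<^sub>a,J\<^sub>b}\<close> with \<open>a \<noteq> b\<close> is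
  \<open>-(S\<^sub>a S\<^sub>b + S\<^sub>b S\<^sub>a)\<close>, whose square is 3. Hence twice it has square \<open>12\<close>, while \<open>C = 6\<close>.\<close>
lemma mixed_square:
  assumes "pairing F" "x \<in> V" "y \<in> V"
  shows "twice_nijenhuis I J (twice_nijenhuis I J F) x y = nat_multiple 2 (spin_component F x y)"
  using assms by (simp add: expand)

text \<open>Put \<open>N\<^sub>a = {J\<^sub>a,J\<^sub>a}\<close>. On spin 3/2, \<open>N\<^sub>a = 1/2 - 2 S\<^sub>a\<^sup>2\<close> and \<open>S\<^sub>1\<^sup>2 + S\<^sub>2\<^sup>2 + S\<^sub>3\<^sup>2 = 15/4\<close>, so
  \<open>N\<^sub>1 + N\<^sub>2 + N\<^sub>3 = -C\<close>; moreover \<open>N\<^sub>a\<^sup>2 = -4 N\<^sub>a\<close>. Substituting \<open>N\<^sub>3 = -C - N\<^sub>1 - N\<^sub>2\<close> into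
  \<open>N\<^sub>3\<^sup>2 = -4 N\<^sub>3\<close> and using \<open>C N\<^sub>a = N\<^sub>a C = 6 N\<^sub>a\<close> and \<open>C\<^sup>2 = 6 C\<close> leaves
  \<open>2 C = -4 (N\<^sub>1 + N\<^sub>2) - N\<^sub>1 N\<^sub>2 - N\<^sub>2 N\<^sub>1\<close>, and the lemma is 4 times
  this identity, written with the operators \<open>2 N\<^sub>a\<close>.\<close>
lemma two_squares:
  assumes "pairing F" "x \<in> V" "y \<in> V"
  shows "nat_multiple 8 (spin_component F x y) =
    - nat_multiple 8 (twice_nijenhuis I I F x y) - nat_multiple 8 (twice_nijenhuis J J F x y)
    - twice_nijenhuis I I (twice_nijenhuis J J F) x y
    - twice_nijenhuis J J (twice_nijenhuis I I F) x y"
  using assms by (simp add: expand)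

section \<open>Vanishing of the Nijenhuis operators\<close>

definition vanishes :: "('v \<Rightarrow> 'v \<Rightarrow> 'v) \<Rightarrow> bool" where
  "vanishes F \<longleftrightarrow> (\<forall>x\<in>V. \<forall>y\<in>V. F x y = 0)"

lemma vanishes_twice_nijenhuis:
  assumes "S \<in> {I, J, K}" "T \<in> {I, J, K}" "vanishes F"
  shows "vanishes (twice_nijenhuis S T F)"
  using assms V_action[of S] V_action[of T] action_zero[of S] action_zero[of T]
  by (simp add: vanishes_def twice_nijenhuis_def del: insert_iff)

lemma twice_nijenhuis_in_W:
  assumes "pairing F" "x \<in> V" "y \<in> V"
  shows "twice_nijenhuis I I F x y \<in> W" "twice_nijenhuis I J F x y \<in> W"
  using assms by (simp_all add: twice_nijenhuis_def action_simps pairingD)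

lemma spin_component_in_W:
  assumes "pairing F" "x \<in> V" "y \<in> V"
  shows "spin_component F x y \<in> W"
  using assms by (simp add: spin_component_def spin_summand_def action_simps pairingD)

lemma spin_component_vanishes_if_mixed:
  assumes F: "pairing F" and IJ: "vanishes (twice_nijenhuis I J F)"
  shows "vanishes (spin_component F)"
  unfolding vanishes_def
proof (intro ballI)
  fix x y assume xy: "x \<in> V" "y \<in> V"
  have "nat_multiple 2 (spin_component F x y) = 0"
    using mixed_square[OF F xy] vanishes_twice_nijenhuis[OF _ _ IJ, of I J] xy
    by (simp add: vanishes_def)
  then show "spin_component F x y = 0"
    using torsion_free[OF _ spin_component_in_W[OF F xy], of 2] by simp
qed

lemma spin_component_vanishes_if_two_squares:
  assumes F: "pairing F"
    and II: "vanishes (twice_nijenhuis I I F)" and JJ: "vanishes (twice_nijenhuis J J F)"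
  shows "vanishes (spin_component F)"
  unfolding vanishes_def
proof (intro ballI)
  fix x y assume xy: "x \<in> V" "y \<in> V"
  have "nat_multiple 8 (spin_component F x y) = 0"
    using two_squares[OF F xy] vanishes_twice_nijenhuis[OF _ _ II, of J J]
      vanishes_twice_nijenhuis[OF _ _ JJ, of I I] II JJ xy
    by (simp add: vanishes_def nat_multiple_simps)
  then show "spin_component F x y = 0"
    using torsion_free[OF _ spin_component_in_W[OF F xy], of 8] by simp
qed

lemma vanish_if_spin_component_vanishes:
  assumes F: "pairing F" and C: "vanishes (spin_component F)"
  shows "vanishes (twice_nijenhuis I I F)" "vanishes (twice_nijenhuis I J F)"
proof -
  have "twice_nijenhuis I I F x y = 0 \<and> twice_nijenhuis I J F x y = 0"
    if xy: "x \<in> V" "y \<in> V" for x y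
  proof -
    have "nat_multiple 6 (twice_nijenhuis I I F x y) = 0"
         "nat_multiple 6 (twice_nijenhuis I J F x y) = 0"
      using same_spin_component[OF F xy] mixed_spin_component[OF F xy] xy
        vanishes_twice_nijenhuis[OF _ _ C, of I I] vanishes_twice_nijenhuis[OF _ _ C, of I J]
      by (simp_all add: vanishes_def)
    then show ?thesis
      using torsion_free[OF _ twice_nijenhuis_in_W(1)[OF F xy], of 6]
        torsion_free[OF _ twice_nijenhuis_in_W(2)[OF F xy], of 6] by simp
  qed
  then show "vanishes (twice_nijenhuis I I F)" "vanishes (twice_nijenhuis I J F)"
    by (simp_all add: vanishes_def)
qed

end

text \<open>The algebraic form of the theorem. The operator \<open>C\<close> is invariant under cyclic permutation of
  the three structures, so it serves all six index pairs at once.\<close>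
proposition (in hypercomplex_action) two_vanish_imp_all_vanish:
  assumes F: "pairing F"
    and hyp: "vanishes (twice_nijenhuis I J F) \<or> vanishes (twice_nijenhuis J K F)
      \<or> vanishes (twice_nijenhuis K I F)
      \<or> vanishes (twice_nijenhuis I I F) \<and> vanishes (twice_nijenhuis J J F)
      \<or> vanishes (twice_nijenhuis J J F) \<and> vanishes (twice_nijenhuis K K F)
      \<or> vanishes (twice_nijenhuis K K F) \<and> vanishes (twice_nijenhuis I I F)"
  shows "vanishes (twice_nijenhuis I I F)" "vanishes (twice_nijenhuis J J F)"
    "vanishes (twice_nijenhuis K K F)" "vanishes (twice_nijenhuis I J F)"
    "vanishes (twice_nijenhuis J K F)" "vanishes (twice_nijenhuis K I F)"
proof -
  interpret JKI: hypercomplex_action V W J K I by (rule rotate)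
  interpret KIJ: hypercomplex_action V W K I J by (rule JKI.rotate)
  have rotated: "JKI.spin_component F = spin_component F" "KIJ.spin_component F = spin_component F"
    by (auto simp: fun_eq_iff spin_component_def JKI.spin_component_def KIJ.spin_component_def
        add_ac)
  have C: "vanishes (spin_component F)"
    using hyp spin_component_vanishes_if_mixed[OF F]
      JKI.spin_component_vanishes_if_mixed[OF F] KIJ.spin_component_vanishes_if_mixed[OF F]
      spin_component_vanishes_if_two_squares[OF F]
      JKI.spin_component_vanishes_if_two_squares[OF F]
      KIJ.spin_component_vanishes_if_two_squares[OF F]
    unfolding rotated by blast
  show "vanishes (twice_nijenhuis I I F)" "vanishes (twice_nijenhuis I J F)"
    using vanish_if_spin_component_vanishes[OF F C] .
  show "vanishes (twice_nijenhuis J J F)" "vanishes (twice_nijenhuis J K F)"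
    using JKI.vanish_if_spin_component_vanishes[OF F] C unfolding rotated by blast+
  show "vanishes (twice_nijenhuis K K F)" "vanishes (twice_nijenhuis K I F)"
    using KIJ.vanish_if_spin_component_vanishes[OF F] C unfolding rotated by blast+
qed

section \<open>Vector fields on a manifold\<close>

text \<open>Fields of tangent vectors without a smoothness condition, set to zero outside the manifold.\<close>
definition rough_fields :: "('m, 'e::euclidean_space) charted_space \<Rightarrow> 'm vfield set" where
  "rough_fields M = {X. (\<forall>p\<in>points M. X p \<in> tangent_space M p) \<and> (\<forall>p. p \<notin> points M \<longrightarrow> X p = 0)}"

lemma tangent_space_zero: "0 \<in> tangent_space M p"
  by (simp add: tangent_space_def)

lemma tangent_space_add:
  "v \<in> tangent_space M p \<Longrightarrow> w \<in> tangent_space M p \<Longrightarrow> v + w \<in> tangent_space M p"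
  by (simp add: tangent_space_def algebra_simps)

lemma tangent_space_minus: "v \<in> tangent_space M p \<Longrightarrow> - v \<in> tangent_space M p"
  by (simp add: tangent_space_def algebra_simps)

lemma nat_multiple_vfield: "nat_multiple n (X :: 'm vfield) p f = real n * X p f"
  by (induction n) (simp_all add: nat_multiple_simps algebra_simps)

lemma tensor11_field_rough:
  assumes "tensor11_field M T" "X \<in> rough_fields M"
  shows "tapply T X \<in> rough_fields M"
  using assms by (simp add: tensor11_field_def rough_fields_def tapply_def)

lemma tensor11_field_add:
  assumes "tensor11_field M T" "X \<in> rough_fields M" "Y \<in> rough_fields M"
  shows "tapply T (X + Y) = tapply T X + tapply T Y"
proof
  show "tapply T (X + Y) p = (tapply T X + tapply T Y) p" for p
    using assms by (cases "p \<in> points M") (simp_all add: tensor11_field_def rough_fields_def tapply_def)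
qed

lemma almost_complex_square:
  assumes "almost_complex_structure M T" "X \<in> rough_fields M"
  shows "tapply T (tapply T X) = - X"
proof
  show "tapply T (tapply T X) p = (- X) p" for p
    using assms by (cases "p \<in> points M")
      (simp_all add: almost_complex_structure_def tensor11_field_def rough_fields_def tapply_def)
qed

lemma almost_hypercomplex_mult:
  assumes J: "almost_hypercomplex_structure M J" and X: "X \<in> rough_fields M"
    and abc: "(a, b, c) \<in> {(1, 2, 3), (2, 3, 1), (3, 1, 2)}"
  shows "tapply (J b) (tapply (J c) X) = tapply (J a) X"
    "tapply (J c) (tapply (J b) X) = - tapply (J a) X"
proof -
  have J0: "J i p v = 0" if "i \<in> {1, 2, 3}" "p \<notin> points M" for i p v
    using J that unfolding almost_hypercomplex_structure_def almost_complex_structure_def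
      tensor11_field_def by blast
  have "J b p (J c p (X p)) = J a p (X p) \<and> J c p (J b p (X p)) = - J a p (X p)" for p
  proof (cases "p \<in> points M")
    case True
    then have "X p \<in> tangent_space M p" using X by (simp add: rough_fields_def)
    with True have "J a p (X p) = J b p (J c p (X p)) \<and> J a p (X p) = - J c p (J b p (X p))"
      using J abc unfolding almost_hypercomplex_structure_def by blast
    then show ?thesis by (metis minus_minus)
  next
    case False
    then show ?thesis using J0[OF _ False] abc by auto
  qed
  then show "tapply (J b) (tapply (J c) X) = tapply (J a) X"
    "tapply (J c) (tapply (J b) X) = - tapply (J a) X"
    by (simp_all add: tapply_def fun_eq_iff)
qed

lemma hypercomplex_action_on_fields:
  assumes J: "almost_hypercomplex_structure M J"
  shows "hypercomplex_action (Collect (vector_field M)) (rough_fields M)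
    (tapply (J 1)) (tapply (J 2)) (tapply (J 3))"
proof -
  have acs: "almost_complex_structure M (J i)" if "i \<in> {1, 2, 3}" for i
    using J that unfolding almost_hypercomplex_structure_def by blast
  then have tensor: "tensor11_field M (J i)" if "i \<in> {1, 2, 3}" for i
    using that by (simp add: almost_complex_structure_def)
  note mult = almost_hypercomplex_mult[OF J]
  show ?thesis
  proof
    show "Collect (vector_field M) \<subseteq> rough_fields M"
      by (auto simp: vector_field_def rough_fields_def)
    show "0 \<in> rough_fields M"
      by (simp add: rough_fields_def tangent_space_zero)
    show "X + Y \<in> rough_fields M" if "X \<in> rough_fields M" "Y \<in> rough_fields M" for X Y
      using that by (simp add: rough_fields_def tangent_space_add)
    show "- X \<in> rough_fields M" if "X \<in> rough_fields M" for X
      using that by (simp add: rough_fields_def tangent_space_minus)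
    show "\<forall>T\<in>{tapply (J 1), tapply (J 2), tapply (J 3)}. \<forall>X\<in>Collect (vector_field M). T X \<in> Collect (vector_field M)"
      using tensor[of 1] tensor[of 2] tensor[of 3] by (simp add: tensor11_field_def)
    show "\<forall>T\<in>{tapply (J 1), tapply (J 2), tapply (J 3)}. \<forall>X\<in>rough_fields M. T X \<in> rough_fields M"
      using tensor[of 1] tensor[of 2] tensor[of 3] by (simp add: tensor11_field_rough)
    show "\<forall>T\<in>{tapply (J 1), tapply (J 2), tapply (J 3)}.
        \<forall>X\<in>rough_fields M. \<forall>Y\<in>rough_fields M. T (X + Y) = T X + T Y"
      using tensor[of 1] tensor[of 2] tensor[of 3] by (simp add: tensor11_field_add)
    show "\<forall>T\<in>{tapply (J 1), tapply (J 2), tapply (J 3)}. \<forall>X\<in>rough_fields M. T (T X) = - X"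
      using acs[of 1] acs[of 2] acs[of 3] by (simp add: almost_complex_square)
    show "X = 0" if "n > 0" "nat_multiple n X = 0" for n and X :: "'a vfield"
    proof (intro ext)
      fix p f
      have "real n * X p f = 0"
        using that(2) nat_multiple_vfield[of n X p f] by simp
      then show "X p f = 0 p f" using that(1) by simp
    qed
  qed (rule mult; simp)+
qed

lemma smooth_fun_const:
  fixes M :: "('m, 'e::euclidean_space) charted_space"
  shows "smooth_fun M (\<lambda>_. c)"
proof -
  have "Ck_on k S (\<lambda>_::'e. c)" for k S and c :: real
    by (induction k arbitrary: c) (simp_all add: frechet_derivative_const)
  then show ?thesis
    by (auto simp: smooth_fun_def smooth_on_def comp_def)
qed

text \<open>The field \<open>- X\<close> is \<open>X\<close> scaled by the constant function \<open>-1\<close>, whose derivatives vanish, so the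
  product rule of the connection applies.\<close>
lemma affine_connection_minus:
  assumes nabla: "affine_connection M nabla" and XY: "vector_field M X" "vector_field M Y"
  shows "nabla (- X) Y = - nabla X Y" "nabla X (- Y) = - nabla X Y"
proof -
  have minus: "- Z = fscale (\<lambda>_. -1) Z" for Z :: "'a vfield"
    by (simp add: fun_eq_iff fscale_def tscale_def)
  have zero: "deriv_along X (\<lambda>_. -1) p = 0" for p
  proof (cases "p \<in> points M")
    case True
    then have X: "X p \<in> tangent_space M p" using XY by (simp add: vector_field_def)
    have "X p (\<lambda>q. 1 * 1) = 1 * X p (\<lambda>q. 1) + 1 * X p (\<lambda>q. 1)"
      using X smooth_fun_const unfolding tangent_space_def by blast
    then have one: "X p (\<lambda>q. 1) = 0" by simp
    have "X p (\<lambda>q. (-1) * 1) = (-1) * X p (\<lambda>q. 1)"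
      using X smooth_fun_const unfolding tangent_space_def by blast
    with one show ?thesis by (simp add: deriv_along_def)
  next
    case False
    then show ?thesis using XY by (simp add: vector_field_def deriv_along_def)
  qed
  show "nabla (- X) Y = - nabla X Y"
    unfolding minus using nabla XY smooth_fun_const unfolding affine_connection_def by blast
  have "nabla X (- Y) = fscale (deriv_along X (\<lambda>_. -1)) Y + fscale (\<lambda>_. -1) (nabla X Y)"
    unfolding minus[of Y] using nabla XY smooth_fun_const unfolding affine_connection_def by blast
  also have "fscale (deriv_along X (\<lambda>_. -1)) Y = 0"
    by (simp add: fun_eq_iff fscale_def tscale_def zero)
  finally show "nabla X (- Y) = - nabla X Y" by (simp only: minus[of "nabla X Y"] add_0_left)
qed

lemma assoc_nijenhuis_vanishes_iff:
  "assoc_nijenhuis_vanishes M nabla S T \<longleftrightarrow>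
     (\<forall>x\<in>Collect (vector_field M). \<forall>y\<in>Collect (vector_field M).
        twice_nijenhuis (tapply S) (tapply T) (sym_bracket nabla) x y = 0)"
proof -
  have "fscale (\<lambda>p. 1 / 2) X = 0 \<longleftrightarrow> X = 0" for X :: "'a vfield"
    by (simp add: fun_eq_iff fscale_def tscale_def)
  then show ?thesis
    by (simp add: assoc_nijenhuis_vanishes_def assoc_nijenhuis_def Let_def twice_nijenhuis_def)
qed

theorem theorem12p7:
  fixes M :: "('m, 'e::euclidean_space) charted_space"
    and n :: nat
    and g :: "'m tensor02"
    and nabla :: "'m connection"
    and J :: "nat \<Rightarrow> 'm tensor11"
    and a b c d :: nat
  assumes "smooth_manifold M"
    and "DIM('e) = 4 * n"
    and "pseudo_riemannian_metric M g"
    and "levi_civita_connection M g nabla"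
    and "almost_hypercomplex_structure M J"
    and "(a, b) \<in> nijenhuis_index_pairs"
    and "(c, d) \<in> nijenhuis_index_pairs"
    and "(a, b) \<noteq> (c, d)"
    and "assoc_nijenhuis_vanishes M nabla (J a) (J b)"
    and "assoc_nijenhuis_vanishes M nabla (J c) (J d)"
  shows "\<forall>(i, j)\<in>nijenhuis_index_pairs. assoc_nijenhuis_vanishes M nabla (J i) (J j)"
proof -
  interpret hypercomplex_action "Collect (vector_field M)" "rough_fields M"
    "tapply (J 1)" "tapply (J 2)" "tapply (J 3)"
    by (rule hypercomplex_action_on_fields) fact
  have nabla: "affine_connection M nabla"
    using assms(4) by (simp add: levi_civita_connection_def)
  have "nabla x y \<in> rough_fields M" if "vector_field M x" "vector_field M y" for x y
    using nabla that V_subset_W unfolding affine_connection_def by blast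
  then have B: "pairing (sym_bracket nabla)"
    using affine_connection_minus[OF nabla] W_add by (simp add: pairing_def sym_bracket_def)
  have iff: "assoc_nijenhuis_vanishes M nabla (J i) (J j) \<longleftrightarrow>
      vanishes (twice_nijenhuis (tapply (J i)) (tapply (J j)) (sym_bracket nabla))" for i j
    unfolding assoc_nijenhuis_vanishes_iff vanishes_def ..
  note two_vanish = two_vanish_imp_all_vanish[OF B, folded iff]
  \<comment> \<open>If neither pair is mixed, they are two of \<open>(1,1)\<close>, \<open>(2,2)\<close>, \<open>(3,3)\<close>.\<close>
  have "assoc_nijenhuis_vanishes M nabla (J 1) (J 2)
      \<or> assoc_nijenhuis_vanishes M nabla (J 2) (J 3)
      \<or> assoc_nijenhuis_vanishes M nabla (J 3) (J 1)
      \<or> assoc_nijenhuis_vanishes M nabla (J 1) (J 1) \<and> assoc_nijenhuis_vanishes M nabla (J 2) (J 2)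
      \<or> assoc_nijenhuis_vanishes M nabla (J 2) (J 2) \<and> assoc_nijenhuis_vanishes M nabla (J 3) (J 3)
      \<or> assoc_nijenhuis_vanishes M nabla (J 3) (J 3) \<and> assoc_nijenhuis_vanishes M nabla (J 1) (J 1)"
    using assms(6-10) unfolding nijenhuis_index_pairs_def by auto
  from two_vanish[OF this] show ?thesis
    unfolding nijenhuis_index_pairs_def by simp
qed

end
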